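(* Let $a$ be an $\mathscr{R}$-diagonal element in a $C^\ast$-probability space $(\mathscr{A},\phi)$. Then for every $n\ge1$ the non-vanishing cumulants of $a$ satisfy \[ |\alpha_n[a]|,\ |\beta_n[a]|\ \le\ \tfrac12\,(2^4\|a\|)^{2n}, \] where $\alpha_n[a]=\kappa_{2n}[a,a^\ast,\dots,a,a^\ast]$ and $\beta_n[a]=\kappa_{2n}[a^\ast,a,\dots,a^\ast,a]$ are the determining sequences of $a$.
   Context: A $C^\ast$-probability space is a unital $C^\ast$-algebra $\mathscr{A}$ with a faithful state $\phi$. Free cumulants $\kappa_n$ are the multilinear functionals determined by $\phi(x_1\cdots x_n)=\sum_{\pi\in NC(n)}\prod_{V\in\pi}\kappa_{|V|}[x_i:i\in V]$ (arguments in increasing order), where $NC(n)$ is the set of non-crossing partitions of $\{1,\dots,n\}$. $a$ is $\mathscr{R}$-diagonal if the only possibly non-vanishing free cumulants with arguments in $\{a,a^\ast\}$ are the alternating ones $\kappa_{2n}[a,a^\ast,\dots,a,a^\ast]$ and $\kappa_{2n}[a^\ast,a,\dots,a^\ast,a]$ (each with $2n$ arguments). *)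

theory Defs
  imports "HOL-Analysis.Analysis" "HOL-Library.Disjoint_Sets"
begin

section \<open>Unital C*-algebras and faithful states\<close>

text \<open>The inherited axiom \<open>norm 1 = 1\<close> only excludes the zero algebra, which carries no state.\<close>

class cstar_algebra = real_normed_algebra_1 + banach +
  fixes scaleC :: "complex \<Rightarrow> 'a \<Rightarrow> 'a" (infixr "*\<^sub>C" 75)
    and star :: "'a \<Rightarrow> 'a"
  assumes scaleC_add_right: "c *\<^sub>C (x + y) = c *\<^sub>C x + c *\<^sub>C y"
    and scaleC_add_left: "(c + d) *\<^sub>C x = c *\<^sub>C x + d *\<^sub>C x"
    and scaleC_scaleC: "c *\<^sub>C d *\<^sub>C x = (c * d) *\<^sub>C x"
    and scaleC_of_real: "complex_of_real r *\<^sub>C x = scaleR r x"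
    and mult_scaleC_left: "(c *\<^sub>C x) * y = c *\<^sub>C (x * y)"
    and mult_scaleC_right: "x * (c *\<^sub>C y) = c *\<^sub>C (x * y)"
    and norm_scaleC: "norm (c *\<^sub>C x) = cmod c * norm x"
    and star_star: "star (star x) = x"
    and star_add: "star (x + y) = star x + star y"
    and star_scaleC: "star (c *\<^sub>C x) = cnj c *\<^sub>C star x"
    and star_mult: "star (x * y) = star y * star x"
    and cstar_identity: "norm (star x * x) = (norm x)\<^sup>2"

lemma vector_space_scaleC: "vector_space (scaleC :: complex \<Rightarrow> 'a::cstar_algebra \<Rightarrow> 'a)"
  by unfold_locales
    (use scaleC_of_real[of 1] in \<open>simp_all add: scaleC_add_right scaleC_add_left scaleC_scaleC\<close>)

instantiation complex :: cstar_algebra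
begin

definition scaleC_complex :: "complex \<Rightarrow> complex \<Rightarrow> complex"
  where "scaleC_complex = times"

definition star_complex :: "complex \<Rightarrow> complex"
  where "star_complex = cnj"

instance
  by standard
    (simp_all add: scaleC_complex_def star_complex_def algebra_simps norm_mult scaleR_conv_of_real power2_eq_square)

end

definition state :: "('a::cstar_algebra \<Rightarrow> complex) \<Rightarrow> bool"
  where "state \<phi> \<longleftrightarrow>
    Vector_Spaces.linear scaleC times \<phi> \<and> (\<forall>x. \<phi> (star x * x) \<in> \<real>\<^sub>\<ge>\<^sub>0) \<and> \<phi> 1 = 1"

definition faithful_state :: "('a::cstar_algebra \<Rightarrow> complex) \<Rightarrow> bool"
  where "faithful_state \<phi> \<longleftrightarrow> state \<phi> \<and> (\<forall>x. \<phi> (star x * x) = 0 \<longrightarrow> x = 0)"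


section \<open>Non-crossing partitions and free cumulants\<close>

definition noncrossing :: "'i::linorder set set \<Rightarrow> bool"
  where "noncrossing \<pi> \<longleftrightarrow>
    \<not> (\<exists>V\<in>\<pi>. \<exists>W\<in>\<pi>. V \<noteq> W \<and> (\<exists>i\<in>V. \<exists>j\<in>W. \<exists>k\<in>V. \<exists>l\<in>W. i < j \<and> j < k \<and> k < l))"

text \<open>List positions start at 0, so \<open>NC n\<close> partitions \<open>{0, \<dots>, n - 1}\<close> rather than
  \<open>{1, \<dots>, n}\<close>.\<close>

definition NC :: "nat \<Rightarrow> nat set set set"
  where "NC n = {\<pi>. partition_on {..<n} \<pi> \<and> noncrossing \<pi>}"

lemma finite_NC: "finite (NC n)"
  by (rule finite_subset[OF _ finitely_many_partition_on[of "{..<n}"]]) (auto simp: NC_def)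

lemma one_block_in_NC: "n \<noteq> 0 \<Longrightarrow> {{..<n}} \<in> NC n"
  by (auto simp: NC_def noncrossing_def partition_on_def disjoint_def)

lemma length_nths_block:
  assumes "\<pi> \<in> NC (length xs)" "\<pi> \<noteq> {{..<length xs}}" "V \<in> \<pi>"
  shows "length (nths xs V) < length xs"
proof -
  have p: "partition_on {..<length xs} \<pi>"
    using assms(1) by (simp add: NC_def)
  have sub: "V \<subseteq> {..<length xs}"
    using p assms(3) by (auto simp: partition_on_def)
  have "V \<noteq> {..<length xs}"
  proof
    assume V: "V = {..<length xs}"
    have "W = V" if W: "W \<in> \<pi>" for W
    proof (rule ccontr)
      assume "W \<noteq> V"
      then have "W \<inter> V = {}"
        using p W assms(3) by (auto simp: partition_on_def disjoint_def)
      moreover have "W \<subseteq> V" "W \<noteq> {}"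
        using p W V by (auto simp: partition_on_def)
      ultimately show False by blast
    qed
    then have "\<pi> = {V}" using assms(3) by blast
    with V assms(2) show False by simp
  qed
  with sub have "V \<subset> {..<length xs}" by blast
  then have "card V < length xs"
    using psubset_card_mono[of "{..<length xs}" V] by simp
  moreover have "{i. i < length xs \<and> i \<in> V} = V" using sub by auto
  ultimately show ?thesis by (simp add: length_nths)
qed

text \<open>\<open>free_cumulant \<phi> [x\<^sub>1, \<dots>, x\<^sub>n]\<close> is \<open>\<kappa>\<^sub>n[x\<^sub>1, \<dots>, x\<^sub>n]\<close>: the moment-cumulant formula solved for the
  term of the one-block partition. The block \<open>V\<close> receives the arguments \<open>nths xs V\<close>, which keep
  their order.\<close>

function free_cumulant :: "('a::monoid_mult \<Rightarrow> complex) \<Rightarrow> 'a list \<Rightarrow> complex" where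
  "free_cumulant \<phi> xs = \<phi> (prod_list xs) -
     (\<Sum>\<pi>\<in>NC (length xs) - {{{..<length xs}}}. \<Prod>V\<in>\<pi>. free_cumulant \<phi> (nths xs V))"
  by auto
termination
proof (relation "Wellfounded.measure (\<lambda>(\<phi>, xs). length xs)")
  fix \<phi> :: "'a \<Rightarrow> complex" and xs :: "'a list" and \<pi> V
  assume "\<pi> \<in> NC (length xs) - {{{..<length xs}}}" "V \<in> \<pi>"
  then show "((\<phi>, nths xs V), \<phi>, xs) \<in> Wellfounded.measure (\<lambda>(\<phi>, xs). length xs)"
    using length_nths_block[of \<pi> xs V] by simp
qed simp

declare free_cumulant.simps [simp del]

theorem moment_cumulant:
  assumes "xs \<noteq> []"
  shows "\<phi> (prod_list xs) = (\<Sum>\<pi>\<in>NC (length xs). \<Prod>V\<in>\<pi>. free_cumulant \<phi> (nths xs V))"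
proof -
  have "nths xs {..<length xs} = xs" by (simp add: nths_upt_eq_take)
  then show ?thesis
    using assms
    by (subst sum.remove[OF finite_NC one_block_in_NC]) (auto simp: free_cumulant.simps[of \<phi> xs])
qed

theorem free_cumulant_unique:
  assumes "\<And>xs. xs \<noteq> [] \<Longrightarrow> \<phi> (prod_list xs) = (\<Sum>\<pi>\<in>NC (length xs). \<Prod>V\<in>\<pi>. \<kappa> (nths xs V))"
    and "xs \<noteq> []"
  shows "\<kappa> xs = free_cumulant \<phi> xs"
  using assms(2)
proof (induction "length xs" arbitrary: xs rule: less_induct)
  case less
  let ?N = "NC (length xs) - {{{..<length xs}}}"
  have eq: "nths xs {..<length xs} = xs" by (simp add: nths_upt_eq_take)
  have "(\<Prod>V\<in>\<pi>. \<kappa> (nths xs V)) = (\<Prod>V\<in>\<pi>. free_cumulant \<phi> (nths xs V))" if "\<pi> \<in> ?N" for \<pi>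
  proof (rule prod.cong[OF refl])
    fix V assume V: "V \<in> \<pi>"
    have "V \<noteq> {}" "V \<subseteq> {..<length xs}"
      using that V by (auto simp: NC_def partition_on_def)
    then have "nths xs V \<noteq> []"
      by (auto simp: set_nths simp flip: set_empty)
    then show "\<kappa> (nths xs V) = free_cumulant \<phi> (nths xs V)"
      using that V by (intro less.hyps length_nths_block) auto
  qed
  then have "(\<Sum>\<pi>\<in>?N. \<Prod>V\<in>\<pi>. \<kappa> (nths xs V)) = (\<Sum>\<pi>\<in>?N. \<Prod>V\<in>\<pi>. free_cumulant \<phi> (nths xs V))"
    by (intro sum.cong) auto
  moreover have "\<phi> (prod_list xs) = \<kappa> xs + (\<Sum>\<pi>\<in>?N. \<Prod>V\<in>\<pi>. \<kappa> (nths xs V))"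
    using assms(1)[OF less.prems] less.prems eq
    by (subst (asm) sum.remove[OF finite_NC one_block_in_NC]) auto
  ultimately show ?case
    by (simp add: free_cumulant.simps[of \<phi> xs])
qed


section \<open>R-diagonal elements\<close>

definition alternating :: "nat \<Rightarrow> 'b \<Rightarrow> 'b \<Rightarrow> 'b list"
  where "alternating n x y = concat (replicate n [x, y])"

text \<open>The arguments in \<open>{a, a*}\<close> are given by words over two formal letters, \<open>True\<close> for \<open>a\<close> and
  \<open>False\<close> for \<open>a*\<close>. This matters only if \<open>a = a*\<close>: then \<open>\<kappa>\<^sub>2[a, a]\<close> still counts as
  non-alternating, whereas the lists \<open>[a, a]\<close> and \<open>[a, a*]\<close> are equal.\<close>

definition R_diagonal :: "('a::cstar_algebra \<Rightarrow> complex) \<Rightarrow> 'a \<Rightarrow> bool"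
  where "R_diagonal \<phi> a \<longleftrightarrow>
    (\<forall>w. (\<forall>n. w \<noteq> alternating n True False \<and> w \<noteq> alternating n False True) \<longrightarrow>
      free_cumulant \<phi> (map (\<lambda>e. if e then a else star a) w) = 0)"

lemma R_diagonal_iff_lists:
  assumes "a \<noteq> star a"
  shows "R_diagonal \<phi> a \<longleftrightarrow>
    (\<forall>xs\<in>lists {a, star a}. (\<forall>n. xs \<noteq> alternating n a (star a) \<and> xs \<noteq> alternating n (star a) a) \<longrightarrow>
      free_cumulant \<phi> xs = 0)"
proof -
  let ?f = "\<lambda>e. if e then a else star a"
  have inj: "inj ?f" using assms by (auto simp: inj_def)
  have alt: "alternating n a (star a) = map ?f (alternating n True False)"
    "alternating n (star a) a = map ?f (alternating n False True)" for n
    by (simp_all add: alternating_def map_concat)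
  have "range ?f = {a, star a}" by (auto simp: image_iff)
  then have "lists {a, star a} = range (map ?f)"
    by (metis lists_UNIV lists_image)
  then show ?thesis
    unfolding R_diagonal_def alt using inj by (simp add: inj_map_eq_map)
qed

definition det_alpha :: "('a::cstar_algebra \<Rightarrow> complex) \<Rightarrow> 'a \<Rightarrow> nat \<Rightarrow> complex"
  where "det_alpha \<phi> a n = free_cumulant \<phi> (alternating n a (star a))"

definition det_beta :: "('a::cstar_algebra \<Rightarrow> complex) \<Rightarrow> 'a \<Rightarrow> nat \<Rightarrow> complex"
  where "det_beta \<phi> a n = free_cumulant \<phi> (alternating n (star a) a)"

end

theory Submission
  imports Defs
begin

text \<open>The recursion that defines the free cumulants has too many terms for a direct estimate, so it is
  inverted. Let \<open>M\<close> and \<open>C\<close> be the non-commutative generating series of the moments and the free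
  cumulants. Summing over the block that contains the first point turns the moment-cumulant formula
  into \<open>M = C(x M)\<close>, where \<open>x M\<close> is substituted for every variable \<open>x\<close>. Hence \<open>C = M(x D)\<close> with
  \<open>D = C\<inverse>\<close>. A state is contractive, because \<open>1 - t\<close> has a self-adjoint square root for self-adjoint
  \<open>t\<close> of norm less than 1, so the coefficients of \<open>M\<close> are bounded by the products of the norms.
  The two equations for \<open>C\<close> and \<open>D\<close> then give a scalar majorant, which at \<open>z = 1/16\<close> exceeds its
  constant term by at most \<open>1/2\<close>.\<close>

section \<open>Contractivity of states\<close>

text \<open>The C*-identity and submultiplicativity give
  \<open>norm y ^ 2 \<le> norm (star y) * norm y\<close>; the reverse comparison is the same one
  applied to \<open>star x\<close>.\<close>

lemma norm_star [simp]: "norm (star x) = norm (x :: 'a::cstar_algebra)"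
proof -
  have le: "norm y \<le> norm (star y)" for y :: 'a
  proof (cases "y = 0")
    case False
    have "norm y * norm y \<le> norm (star y) * norm y"
      using norm_mult_ineq[of "star y" y] by (simp add: cstar_identity power2_eq_square)
    then show ?thesis using False by simp
  qed simp
  show ?thesis using le[of x] le[of "star x"] by (simp add: star_star)
qed

lemma star_scaleR: "star (r *\<^sub>R x) = r *\<^sub>R star (x :: 'a::cstar_algebra)"
  by (simp add: star_scaleC flip: scaleC_of_real)

lemma bounded_linear_star: "bounded_linear (star :: 'a::cstar_algebra \<Rightarrow> 'a)"
  by (rule bounded_linear_intro[of _ 1]) (simp_all add: star_add star_scaleR)

lemma star_one [simp]: "star 1 = (1 :: 'a::cstar_algebra)"
  using star_mult[of "star 1" "1::'a"] by (simp add: star_star)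

lemma star_power: "star (x ^ n) = star (x :: 'a::cstar_algebra) ^ n"
  by (induction n) (simp_all add: star_mult power_commutes)

text \<open>Successive coefficients have ratio (1/2 - n) / (n + 1), of absolute value at most 1. A
  geometric series then dominates the square root series.\<close>

lemma abs_half_gchoose_le: "\<bar>(1 / 2 :: real) gchoose n\<bar> \<le> 1"
proof (induction n)
  case (Suc n)
  have "of_nat (Suc n) * (1 / 2 gchoose Suc n) = (1 / 2 - of_nat n) * (1 / 2 gchoose n :: real)"
    by (simp only: gbinomial_absorb_comp gbinomial_absorption)
  then have "real (Suc n) * \<bar>1 / 2 gchoose Suc n :: real\<bar> = \<bar>1 / 2 - real n\<bar> * \<bar>1 / 2 gchoose n\<bar>"
    by (metis abs_mult abs_of_nat)
  also have "\<dots> \<le> real (Suc n) * 1"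
    using Suc by (intro mult_mono) auto
  finally show ?case by simp
qed simp

text \<open>Square root of \<open>1 - t\<close> by the binomial series.\<close>

lemma one_minus_eq_star_mult:
  fixes t :: "'a::cstar_algebra"
  assumes t: "star t = t" "norm t < 1"
  shows "\<exists>y. 1 - t = star y * y"
proof -
  define f where "f n = ((1 / 2 :: real) gchoose n) *\<^sub>R (- t) ^ n" for n
  have "norm (f n) \<le> norm t ^ n" for n
  proof -
    have "norm (f n) \<le> 1 * norm (- t) ^ n"
      unfolding f_def norm_scaleR using abs_half_gchoose_le[of n]
      by (intro mult_mono norm_power_ineq) auto
    then show ?thesis by simp
  qed
  then have sum: "summable (\<lambda>n. norm (f n))"
    using t(2) by (intro summable_comparison_test'[OF summable_geometric[of "norm t"]]) auto
  define y where "y = suminf f"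
  have "star (f n) = f n" for n
    using t(1) by (simp add: f_def star_scaleR star_power linear_neg[OF bounded_linear.linear[OF bounded_linear_star]])
  then have y: "star y = y"
    unfolding y_def
    by (simp add: bounded_linear.suminf[OF bounded_linear_star summable_norm_cancel[OF sum]])
  \<comment> \<open>By Vandermonde, the Cauchy square has the coefficients of the first power of 1 -
    t, and those vanish beyond degree 1.\<close>
  have "(\<Sum>i\<le>k. f i * f (k - i)) = ((1 :: real) gchoose k) *\<^sub>R (- t) ^ k" for k
  proof -
    have "(\<Sum>i\<le>k. f i * f (k - i)) = (\<Sum>i\<le>k. ((1 / 2 gchoose i) * (1 / 2 gchoose (k - i)) :: real) *\<^sub>R (- t) ^ k)"
      by (intro sum.cong) (auto simp: f_def simp flip: power_add)
    also have "\<dots> = (\<Sum>i\<le>k. (1 / 2 gchoose i) * (1 / 2 gchoose (k - i)) :: real) *\<^sub>R (- t) ^ k"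
      by (simp add: scaleR_left.sum)
    finally show ?thesis
      using gbinomial_Vandermonde[of "1 / 2 :: real" "1 / 2" k] by (simp add: atMost_atLeast0)
  qed
  then have "(\<lambda>k. ((1 :: real) gchoose k) *\<^sub>R (- t) ^ k) sums (y * y)"
    using Cauchy_product_sums[OF sum sum] by (simp add: y_def)
  moreover have "((1 :: real) gchoose k) *\<^sub>R (- t) ^ k = 0" if "k \<notin> {0, 1}" for k
  proof -
    have "1 choose k = 0" using that by (simp add: binomial_eq_0)
    then have "((1 :: real) gchoose k) = 0"
      using binomial_gbinomial[of 1 k, where 'a = real] by (simp only: of_nat_0 of_nat_1)
    then show ?thesis by simp
  qed
  then have "(\<lambda>k. ((1 :: real) gchoose k) *\<^sub>R (- t) ^ k) sums
      (\<Sum>k\<in>{0, 1}. ((1 :: real) gchoose k) *\<^sub>R (- t) ^ k)"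
    by (intro sums_finite) auto
  ultimately have "y * y = (\<Sum>k\<in>{0, 1}. ((1 :: real) gchoose k) *\<^sub>R (- t) ^ k)"
    by (rule sums_unique2)
  then show ?thesis using y by (intro exI[of _ y]) simp
qed

section \<open>Norm bound for states\<close>

lemma scaleC_half: "(1 / 2) *\<^sub>C (x :: 'a::cstar_algebra) = (1 / 2) *\<^sub>R x"
  using scaleC_of_real[of "1 / 2" x] by simp

lemma state_add: "state \<phi> \<Longrightarrow> \<phi> (x + y) = \<phi> x + \<phi> y"
  and state_scaleC: "state \<phi> \<Longrightarrow> \<phi> (c *\<^sub>C x) = c * \<phi> x"
  by (auto simp: state_def Vector_Spaces.linear_iff)

lemma state_scaleR: "state \<phi> \<Longrightarrow> \<phi> (r *\<^sub>R x) = r * \<phi> x"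
  using state_scaleC[of \<phi> "of_real r" x] by (simp add: scaleC_of_real)

text \<open>For c > \<open>norm h\<close> the element 1 - h/c has the form
  \<open>star y * y\<close>, so \<phi> h / c = 1 - r with r \<ge> 0. Strictness serves the binomial
  series; afterwards c tends to \<open>norm h\<close>.\<close>

lemma state_selfadjoint:
  fixes \<phi> :: "'a::cstar_algebra \<Rightarrow> complex"
  assumes \<phi>: "state \<phi>" and h: "star h = h"
  shows "\<phi> h \<in> \<real>" "Re (\<phi> h) \<le> norm h"
proof -
  have le: "\<phi> h \<in> \<real> \<and> Re (\<phi> h) \<le> c" if c: "norm h < c" for c
  proof -
    have "c > 0" using c norm_ge_zero[of h] by linarith
    then obtain y where y: "1 - (1 / c) *\<^sub>R h = star y * y"
      using one_minus_eq_star_mult[of "(1 / c) *\<^sub>R h"] c h by (auto simp: star_scaleR)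
    then have "star y * y + (1 / c) *\<^sub>R h = 1" by (metis diff_add_cancel)
    then have "\<phi> (star y * y) + \<phi> h / c = 1"
      using \<phi> state_add[OF \<phi>, of "star y * y" "(1 / c) *\<^sub>R h"] by (simp add: state_scaleR state_def)
    moreover have "\<phi> (star y * y) \<in> \<real>\<^sub>\<ge>\<^sub>0" using \<phi> by (simp add: state_def)
    then obtain r where "\<phi> (star y * y) = complex_of_real r" "r \<ge> 0"
      by (metis nonneg_Reals_cases)
    ultimately have "\<phi> h / c = 1 - of_real r" and r: "r \<ge> 0"
      by (auto simp: eq_diff_eq add.commute)
    moreover have "\<phi> h = of_real c * (\<phi> h / of_real c)" using \<open>c > 0\<close> by simp
    ultimately have eq: "\<phi> h = of_real (c * (1 - r))"
      by (metis of_real_1 of_real_diff of_real_mult)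
    have "c * (1 - r) \<le> c * 1" using r \<open>c > 0\<close> by (intro mult_left_mono) auto
    then show ?thesis unfolding eq Re_complex_of_real by simp
  qed
  show "\<phi> h \<in> \<real>" using le[of "norm h + 1"] by simp
  show "Re (\<phi> h) \<le> norm h" by (rule dense_ge) (use le in blast)
qed

text \<open>A phase \<open>u\<close> makes \<phi> (u x) equal to \<open>cmod (\<phi> x)\<close>.
  Split u x = h + i k with self-adjoint h and k: \<phi> k is real, so only \<phi> h reaches the real
  part, and \<open>norm h \<le> norm x\<close>.\<close>

lemma state_norm_le:
  fixes \<phi> :: "'a::cstar_algebra \<Rightarrow> complex"
  assumes \<phi>: "state \<phi>"
  shows "cmod (\<phi> x) \<le> norm x"
proof -
  obtain u where u: "cmod u = 1" "u * \<phi> x = of_real (cmod (\<phi> x))"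
  proof (cases "\<phi> x = 0")
    case False
    then show ?thesis
      by (intro that[of "of_real (cmod (\<phi> x)) / \<phi> x"]) (simp_all add: norm_divide)
  qed (use that[of 1] in simp)
  define y where "y = u *\<^sub>C x"
  define h where "h = (1 / 2) *\<^sub>R (y + star y)"
  define k where "k = (- \<i> / 2) *\<^sub>C (y + (- 1) *\<^sub>C star y)"
  have h: "star h = h"
    by (simp add: h_def star_scaleR star_add star_star add.commute)
  have k: "star k = k"
    by (simp add: k_def star_scaleC star_add star_star scaleC_add_right scaleC_scaleC add.commute)
  have y: "y = h + \<i> *\<^sub>C k"
  proof -
    have "\<i> *\<^sub>C k = (1 / 2) *\<^sub>C y + (- (1 / 2)) *\<^sub>C star y"
      by (simp add: k_def scaleC_add_right scaleC_scaleC)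
    moreover have "h = (1 / 2) *\<^sub>C y + (1 / 2) *\<^sub>C star y"
      by (simp add: h_def scaleC_half scaleR_add_right)
    ultimately have "h + \<i> *\<^sub>C k = ((1 / 2) *\<^sub>C y + (1 / 2) *\<^sub>C y) + ((1 / 2) *\<^sub>C star y + (- (1 / 2)) *\<^sub>C star y)"
      by (simp add: algebra_simps)
    also have "\<dots> = y"
      using scaleC_of_real[of 1 y] scaleC_of_real[of 0 "star y"] by (simp flip: scaleC_add_left)
    finally show ?thesis ..
  qed
  have "of_real (cmod (\<phi> x)) = \<phi> h + \<i> * \<phi> k"
    using u y by (metis y_def state_add[OF \<phi>] state_scaleC[OF \<phi>])
  then have "cmod (\<phi> x) = Re (\<phi> h)"
    using state_selfadjoint(1)[OF \<phi> k] by (auto simp: complex_eq_iff complex_is_Real_iff)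
  also have "\<dots> \<le> norm h" by (rule state_selfadjoint(2)[OF \<phi> h])
  also have "\<dots> \<le> norm y" using norm_triangle_ineq[of y "star y"] by (simp add: h_def)
  finally show ?thesis using u(1) by (simp add: y_def norm_scaleC)
qed

section \<open>Series in non-commuting variables\<close>

text \<open>The Cauchy product of formal power series in non-commuting variables.\<close>

definition conv :: "('b list \<Rightarrow> complex) \<Rightarrow> ('b list \<Rightarrow> complex) \<Rightarrow> 'b list \<Rightarrow> complex" (infixl "\<star>" 70)
  where "(A \<star> B) w = (\<Sum>i\<le>length w. A (take i w) * B (drop i w))"

text \<open>A function on words is a formal power series in non-commuting variables. \<open>comp_series A B\<close> is
  the series \<open>A\<close> with every variable \<open>x\<close> replaced by \<open>x B\<close>; the recursion computes its left
  derivative by \<open>x\<close>.\<close>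

function comp_series :: "('b list \<Rightarrow> complex) \<Rightarrow> ('b list \<Rightarrow> complex) \<Rightarrow> 'b list \<Rightarrow> complex" where
  "comp_series A B [] = A []"
| "comp_series A B (x # w) =
     (\<Sum>i\<le>length w. B (take i w) * comp_series (\<lambda>v. A (x # v)) B (drop i w))"
  by pat_completeness auto
termination by (relation "Wellfounded.measure (\<lambda>(A, B, w). length w)") auto

lemma conv_Nil [simp]: "(A \<star> B) [] = A [] * B []"
  by (simp add: conv_def)

text \<open>The product rule for the left derivative by x, which drives inductions on words
  below.\<close>

lemma conv_Cons [simp]: "(A \<star> B) (x # w) = A [] * B (x # w) + ((\<lambda>v. A (x # v)) \<star> B) w"
  unfolding conv_def by (simp add: sum.atMost_Suc_shift del: sum.atMost_Suc)

lemma comp_series_Cons: "comp_series A B (x # w) = (B \<star> comp_series (\<lambda>v. A (x # v)) B) w"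
  by (simp add: conv_def)

section \<open>Algebra of products and substitutions\<close>

lemma conv_cong:
  assumes "\<And>v. length v \<le> length w \<Longrightarrow> A v = A' v" "\<And>v. length v \<le> length w \<Longrightarrow> B v = B' v"
  shows "(A \<star> B) w = (A' \<star> B') w"
  unfolding conv_def using assms by (intro sum.cong) auto

lemma conv_add_left: "((\<lambda>v. A v + B v) \<star> C) w = (A \<star> C) w + (B \<star> C) w"
  by (simp add: conv_def algebra_simps sum.distrib)

lemma conv_scale_left: "((\<lambda>v. c * A v) \<star> B) w = c * (A \<star> B) w"
  by (simp add: conv_def algebra_simps sum_distrib_left)

lemma conv_add_right: "(A \<star> (\<lambda>v. B v + C v)) w = (A \<star> B) w + (A \<star> C) w"
  by (simp add: conv_def algebra_simps sum.distrib)

lemma conv_scale_right: "(A \<star> (\<lambda>v. c * B v)) w = c * (A \<star> B) w"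
  by (simp add: conv_def algebra_simps sum_distrib_left)

lemma conv_assoc: "A \<star> B \<star> C = A \<star> (B \<star> C)"
proof
  show "(A \<star> B \<star> C) w = (A \<star> (B \<star> C)) w" for w
    by (induction w arbitrary: A)
      (simp_all add: conv_add_left conv_scale_left algebra_simps)
qed

definition one_series :: "'b list \<Rightarrow> complex"
  where "one_series w = (if w = [] then 1 else 0)"

lemma one_conv [simp]: "one_series \<star> A = A"
proof
  show "(one_series \<star> A) w = A w" for w
    by (cases w) (simp_all add: one_series_def conv_def if_distrib[of "\<lambda>c. c * _"] cong: if_cong)
qed

text \<open>Each substituted x B spends one letter on x, so B matters on strictly shorter words
  only. This strictness makes fixed points unique.\<close>

lemma comp_series_cong:
  assumes "\<And>v. length v < length w \<Longrightarrow> B v = B' v"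
  shows "comp_series A B w = comp_series A B' w"
  using assms
proof (induction A B w rule: comp_series.induct)
  case (2 A B x w)
  then show ?case by (auto intro!: sum.cong)
qed simp

lemma comp_series_add:
  "comp_series (\<lambda>v. A v + B v) E w = comp_series A E w + comp_series B E w"
proof (induction "length w" arbitrary: A B w rule: less_induct)
  case less
  then show ?case by (cases w) (simp_all add: sum.distrib algebra_simps)
qed

lemma comp_series_scale: "comp_series (\<lambda>v. c * A v) E w = c * comp_series A E w"
proof (induction "length w" arbitrary: A w rule: less_induct)
  case less
  then show ?case by (cases w) (simp_all add: sum_distrib_left mult.left_commute)
qed

text \<open>Both sides obey the same product rule under the left derivative, hence the induction
  with \<open>A\<close> arbitrary. This is what lets substitutions be composed.\<close>

lemma comp_series_conv: "comp_series (A \<star> B) E = comp_series A E \<star> comp_series B E"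
proof
  show "comp_series (A \<star> B) E w = (comp_series A E \<star> comp_series B E) w" for w
  proof (induction "length w" arbitrary: A w rule: less_induct)
    case less
    show ?case
    proof (cases w)
      case (Cons x w')
      let ?A = "\<lambda>v. A (x # v)" and ?B = "\<lambda>v. B (x # v)"
      have "comp_series (A \<star> B) E w =
          (E \<star> (\<lambda>v. A [] * comp_series ?B E v + comp_series (?A \<star> B) E v)) w'"
        unfolding Cons comp_series_Cons conv_Cons
        by (intro conv_cong) (simp_all add: comp_series_add comp_series_scale)
      also have "\<dots> = (E \<star> (\<lambda>v. A [] * comp_series ?B E v + (comp_series ?A E \<star> comp_series B E) v)) w'"
        using less Cons by (intro conv_cong) auto
      also have "\<dots> = (comp_series A E \<star> comp_series B E) w"
        by (simp add: Cons comp_series_Cons conv_add_right conv_scale_right del: comp_series.simps(2) flip: conv_assoc)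
      finally show ?thesis .
    qed simp
  qed
qed

text \<open>Replacing x by x E turns x B into x E B(x E), which explains the combined
  factor.\<close>

lemma comp_series_comp_series:
  "comp_series (comp_series A B) E = comp_series A (E \<star> comp_series B E)"
proof
  show "comp_series (comp_series A B) E w = comp_series A (E \<star> comp_series B E) w" for w
  proof (induction "length w" arbitrary: A w rule: less_induct)
    case less
    show ?case
    proof (cases w)
      case (Cons x w')
      let ?A = "\<lambda>v. A (x # v)" and ?F = "E \<star> comp_series B E"
      have "comp_series (comp_series A B) E w = (?F \<star> comp_series (comp_series ?A B) E) w'"
        by (simp add: Cons comp_series_Cons comp_series_conv conv_assoc del: comp_series.simps(2))
      also have "\<dots> = (?F \<star> comp_series ?A ?F) w'"
        using less Cons by (intro conv_cong) auto
      finally show ?thesis by (simp add: Cons comp_series_Cons del: comp_series.simps(2))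
    qed simp
  qed
qed

lemma comp_series_one [simp]: "comp_series A one_series = A"
proof
  show "comp_series A one_series w = A w" for w
    by (induction w arbitrary: A) (simp_all add: comp_series_Cons del: comp_series.simps(2))
qed

text \<open>Substitute \<open>x D\<close> for \<open>x\<close> in \<open>M = C(x M)\<close>: the series \<open>M(x D)\<close> and \<open>C\<close> both solve
  \<open>N = C(x D N)\<close>, whose solution is unique.\<close>

theorem comp_series_inversion:
  assumes M: "M = comp_series C M" and D: "D \<star> C = one_series"
  shows "C = comp_series M D"
proof
  let ?N = "comp_series M D"
  have C: "C = comp_series C (D \<star> C)" by (simp add: D)
  have N: "?N = comp_series C (D \<star> ?N)"
    using comp_series_comp_series[of C M D] M by simp
  show "C w = ?N w" for w
  proof (induction "length w" arbitrary: w rule: less_induct)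
    case less
    \<comment> \<open>The substituted factor is read only on words shorter than \<open>w\<close>,
      where \<open>C\<close> and \<open>?N\<close> agree by induction.\<close>
    have "comp_series C (D \<star> C) w = comp_series C (D \<star> ?N) w"
      using less by (intro comp_series_cong conv_cong) auto
    then show ?case using C N by metis
  qed
qed

text \<open>The equation D C = 1 solved for its term with the full prefix, whose cofactor
  \<open>C []\<close> is to be 1.\<close>

function left_inverse :: "('b list \<Rightarrow> complex) \<Rightarrow> 'b list \<Rightarrow> complex" where
  "left_inverse C w =
     (if w = [] then 1 else - (\<Sum>i<length w. left_inverse C (take i w) * C (drop i w)))"
  by auto
termination by (relation "Wellfounded.measure (\<lambda>(C, w). length w)") auto

declare left_inverse.simps [simp del]

lemma left_inverse_conv:
  assumes "C [] = 1"
  shows "left_inverse C \<star> C = one_series"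
proof
  show "(left_inverse C \<star> C) w = one_series w" for w
    using assms left_inverse.simps[of C w]
    by (auto simp: one_series_def conv_def left_inverse.simps[of C "[]"] simp flip: lessThan_Suc_atMost)
qed

section \<open>Majorants\<close>

text \<open>With all coefficients of \<open>M\<close> equal to 1, these are the coefficients of \<open>C = M(z D)\<close> and
  \<open>D = 1 / C\<close> after all signs have been made positive: \<open>H = 1 / (1 - z D)\<close> and \<open>D = 1 / (2 - H)\<close>.\<close>

function majorant :: "nat \<Rightarrow> real" and majorant_inv :: "nat \<Rightarrow> real" where
  "majorant 0 = 1"
| "majorant (Suc n) = (\<Sum>i\<le>n. majorant_inv i * majorant (n - i))"
| "majorant_inv 0 = 1"
| "majorant_inv (Suc n) = (\<Sum>i\<le>n. majorant_inv i * majorant (Suc n - i))"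
  by pat_completeness auto
text \<open>\<open>majorant_inv (Suc n)\<close> calls \<open>majorant (Suc n)\<close>, so the extra
  1 ranks \<open>majorant n\<close> just below \<open>majorant_inv n\<close>.\<close>

termination by (relation "Wellfounded.measure (case_sum (\<lambda>n. 2 * n) (\<lambda>n. 2 * n + 1))") auto

lemma majorant_nonneg: "majorant n \<ge> 0" "majorant_inv n \<ge> 0"
  by (induction n and n rule: majorant_majorant_inv.induct) (auto intro!: sum_nonneg)

lemma sum_triangle_le:
  fixes f g :: "nat \<Rightarrow> real"
  assumes "\<And>i. f i \<ge> 0" "\<And>i. g i \<ge> 0"
  shows "(\<Sum>n\<le>N. \<Sum>i\<le>n. f i * g (n - i)) \<le> (\<Sum>i\<le>N. f i) * (\<Sum>j\<le>N. g j)"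
proof -
  have "(\<Sum>n\<le>N. \<Sum>i\<le>n. f i * g (n - i)) = (\<Sum>(i, j)\<in>{(i, j). i + j \<le> N}. f i * g j)"
    by (simp add: sum.triangle_reindex_eq)
  also have "\<dots> \<le> (\<Sum>(i, j)\<in>{..N} \<times> {..N}. f i * g j)"
    using assms by (intro sum_mono2) auto
  finally show ?thesis by (simp add: sum_product sum.cartesian_product)
qed

text \<open>The bounds \<open>3/2\<close> and \<open>2\<close> reproduce themselves at \<open>z = 1/16\<close>, since \<open>1 + 2 (3/2)/16 \<le> 3/2\<close> and
  \<open>1 + 2 (1/2) = 2\<close>.\<close>

lemma majorant_sums:
  "(\<Sum>n\<le>N. majorant n / 16 ^ n) \<le> 3 / 2 \<and> (\<Sum>n\<le>N. majorant_inv n / 16 ^ n) \<le> 2"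
proof (induction N)
  case (Suc N)
  let ?h = "\<lambda>n. majorant n / 16 ^ n" and ?d = "\<lambda>n. majorant_inv n / 16 ^ n"
  have "(\<Sum>n\<le>Suc N. ?h n) = 1 + (\<Sum>n\<le>N. \<Sum>i\<le>n. ?d i * ?h (n - i)) / 16"
    by (auto simp: sum.atMost_Suc_shift sum_divide_distrib power_add[symmetric] simp del: sum.atMost_Suc intro!: sum.cong)
  also have "\<dots> \<le> 1 + ((\<Sum>i\<le>N. ?d i) * (\<Sum>j\<le>N. ?h j)) / 16"
    using majorant_nonneg by (intro add_left_mono divide_right_mono sum_triangle_le) auto
  also have "\<dots> \<le> 1 + (2 * (3 / 2)) / 16"
    using Suc majorant_nonneg
    by (intro add_left_mono divide_right_mono mult_mono) (auto intro!: sum_nonneg)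
  finally have h: "(\<Sum>n\<le>Suc N. ?h n) \<le> 3 / 2" by simp
  \<comment> \<open>Dropping the constant term 1 leaves 1/2; this remainder bounds H - 1 in D = 1 +
    D (H - 1).\<close>
  then have h': "(\<Sum>n\<le>N. ?h (Suc n)) \<le> 1 / 2"
    by (simp add: sum.atMost_Suc_shift del: sum.atMost_Suc majorant.simps(2))
  have "(\<Sum>n\<le>Suc N. ?d n) = 1 + (\<Sum>n\<le>N. \<Sum>i\<le>n. ?d i * ?h (Suc (n - i)))"
    by (auto simp: sum.atMost_Suc_shift sum_divide_distrib power_add[symmetric] Suc_diff_le simp del: sum.atMost_Suc majorant.simps(2) intro!: sum.cong)
  also have "\<dots> \<le> 1 + (\<Sum>i\<le>N. ?d i) * (\<Sum>j\<le>N. ?h (Suc j))"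
    using majorant_nonneg by (intro add_left_mono sum_triangle_le[where g="\<lambda>j. ?h (Suc j)"]) (auto simp del: majorant.simps(2))
  also have "\<dots> \<le> 1 + 2 * (1 / 2)"
    using Suc h' majorant_nonneg
    by (intro add_left_mono mult_mono) (auto intro!: sum_nonneg simp del: majorant.simps(2))
  finally show ?case using h by simp
qed simp

text \<open>One term is at most the sum without the constant term; this is the origin of the factor
  1/2 and of the restriction to \<open>n \<ge> 1\<close>.\<close>

lemma majorant_le:
  assumes "n \<ge> 1"
  shows "majorant n \<le> 1 / 2 * 16 ^ n"
proof -
  obtain k where n: "n = Suc k" using assms by (cases n) auto
  have "majorant n / 16 ^ n \<le> (\<Sum>i\<le>k. majorant (Suc i) / 16 ^ Suc i)"
    unfolding n using majorant_nonneg
    by (intro member_le_sum[where f="\<lambda>i. majorant (Suc i) / 16 ^ Suc i"]) (auto simp del: majorant.simps(2))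
  also have "\<dots> \<le> 1 / 2"
    using majorant_sums[of "Suc k"]
    by (simp add: sum.atMost_Suc_shift del: sum.atMost_Suc majorant.simps(2))
  finally show ?thesis by (simp add: field_simps)
qed

text \<open>The constant \<open>K\<close> serves the induction: the left derivative by x replaces it
  by \<open>K * r x\<close>. Bounding \<open>D\<close> on shorter words only makes the lemma usable
  in a simultaneous induction on both series.\<close>

lemma comp_series_bound:
  fixes r :: "'b \<Rightarrow> real"
  assumes r: "\<And>x. r x \<ge> 0"
    and A: "\<And>v. cmod (A v) \<le> K * prod_list (map r v)"
    and D: "\<And>v. length v < length w \<Longrightarrow> cmod (D v) \<le> majorant_inv (length v) * prod_list (map r v)"
  shows "cmod (comp_series A D w) \<le> K * majorant (length w) * prod_list (map r w)"
  using A D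
proof (induction "length w" arbitrary: A K w rule: less_induct)
  case less
  have p: "prod_list (map r v) \<ge> 0" for v using r by (induction v) auto
  show ?case
  proof (cases w)
    case Nil
    then show ?thesis using less.prems(1)[of "[]"] by simp
  next
    case (Cons x w')
    have "cmod (D (take i w') * comp_series (\<lambda>v. A (x # v)) D (drop i w'))
        \<le> K * (majorant_inv i * majorant (length w' - i)) * prod_list (map r w)" if i: "i \<le> length w'" for i
    proof -
      have 1: "cmod (D (take i w')) \<le> majorant_inv i * prod_list (map r (take i w'))"
        using less.prems(2)[of "take i w'"] Cons i by simp
      have 2: "cmod (comp_series (\<lambda>v. A (x # v)) D (drop i w')) \<le> (K * r x) * majorant (length w' - i) * prod_list (map r (drop i w'))"
        using less.hyps[of "drop i w'" "\<lambda>v. A (x # v)" "K * r x"] less.prems(1)[of "x # _"] less.prems(2) Cons i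
        by (simp add: mult.assoc)
      have "prod_list (map r w') = prod_list (map r (take i w')) * prod_list (map r (drop i w'))"
        by (metis append_take_drop_id map_append prod_list.append)
      then show ?thesis
        using mult_mono[OF 1 2] majorant_nonneg p by (simp add: Cons norm_mult algebra_simps)
    qed
    then have "cmod (comp_series A D w) \<le> (\<Sum>i\<le>length w'. K * (majorant_inv i * majorant (length w' - i)) * prod_list (map r w))"
      unfolding Cons comp_series.simps by (intro sum_norm_le) (simp add: Cons)
    then show ?thesis by (simp add: Cons sum_distrib_left sum_distrib_right)
  qed
qed

text \<open>The induction alternates: \<open>C\<close> is bounded from \<open>left_inverse C\<close>
  on shorter words, then \<open>left_inverse C\<close> from \<open>C\<close> up to the same length.
  Absolute values turn the minus sign of \<open>left_inverse\<close> into the plus sign of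
  \<open>majorant_inv\<close>.\<close>

theorem inversion_bound:
  fixes r :: "'b \<Rightarrow> real"
  assumes r: "\<And>x. r x \<ge> 0" and M: "\<And>v. cmod (M v) \<le> prod_list (map r v)"
    and C: "C = comp_series M (left_inverse C)"
  shows "cmod (C w) \<le> majorant (length w) * prod_list (map r w)"
proof -
  have "cmod (left_inverse C w) \<le> majorant_inv (length w) * prod_list (map r w) \<and>
    cmod (C w) \<le> majorant (length w) * prod_list (map r w)"
  proof (induction "length w" arbitrary: w rule: less_induct)
    case less
    have "cmod (C v) \<le> majorant (length v) * prod_list (map r v)" if "length v \<le> length w" for v
      using comp_series_bound[of r M 1 v "left_inverse C"] r M less that C by simp
    note c = this
    have "cmod (left_inverse C w) \<le> majorant_inv (length w) * prod_list (map r w)"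
    proof (cases "length w")
      case (Suc n)
      have "cmod (left_inverse C (take i w) * C (drop i w)) \<le>
          (majorant_inv i * majorant (length w - i)) * prod_list (map r w)" if i: "i \<le> n" for i
      proof -
        have 1: "cmod (left_inverse C (take i w)) \<le> majorant_inv i * prod_list (map r (take i w))"
          using less[of "take i w"] Suc i by simp
        have 2: "cmod (C (drop i w)) \<le> majorant (length w - i) * prod_list (map r (drop i w))"
          using c[of "drop i w"] by simp
        have "prod_list (map r w) = prod_list (map r (take i w)) * prod_list (map r (drop i w))"
          by (metis append_take_drop_id map_append prod_list.append)
        moreover have "prod_list (map r v) \<ge> 0" for v using r by (induction v) auto
        ultimately show ?thesis
          using mult_mono[OF 1 2] majorant_nonneg by (simp add: norm_mult algebra_simps)
      qed
      then have "cmod (\<Sum>i\<le>n. left_inverse C (take i w) * C (drop i w)) \<le>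
          (\<Sum>i\<le>n. (majorant_inv i * majorant (length w - i)) * prod_list (map r w))"
        by (intro sum_norm_le) simp
      then show ?thesis
        using Suc by (auto simp: left_inverse.simps[of C w] lessThan_Suc_atMost sum_distrib_right)
    qed (simp add: left_inverse.simps)
    then show ?case using c by simp
  qed
  then show ?thesis ..
qed

section \<open>Sums over non-crossing partitions\<close>

text \<open>Arbitrary index sets are allowed because the recursion below sums over gaps {p..<j} and
  over sets U \<union> {p..<n}.\<close>

definition nc_partitions :: "'i::linorder set \<Rightarrow> 'i set set set"
  where "nc_partitions A = {\<pi>. partition_on A \<pi> \<and> noncrossing \<pi>}"

text \<open>\<open>W = {}\<close> imposes no condition; it is a separate case because the partition of the empty set
  has no block.\<close>

definition nc_sum :: "('i::linorder set \<Rightarrow> complex) \<Rightarrow> 'i set \<Rightarrow> 'i set \<Rightarrow> complex"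
  where "nc_sum f W A = (\<Sum>\<pi> | \<pi> \<in> nc_partitions A \<and> (W = {} \<or> (\<exists>V\<in>\<pi>. W \<subseteq> V)). \<Prod>V\<in>\<pi>. f V)"

lemma NC_eq_nc_partitions: "NC n = nc_partitions {..<n}"
  by (simp add: NC_def nc_partitions_def)

lemma finite_nc_partitions: "finite A \<Longrightarrow> finite (nc_partitions A)"
  by (rule finite_subset[OF _ finitely_many_partition_on[of A]]) (auto simp: nc_partitions_def)

section \<open>Unions and restrictions of non-crossing partitions\<close>

lemma partition_on_Un:
  assumes "partition_on A P" "partition_on B Q" "A \<inter> B = {}"
  shows "partition_on (A \<union> B) (P \<union> Q)"
proof (rule partition_onI)
  show "\<Union>(P \<union> Q) = A \<union> B" "{} \<notin> P \<union> Q"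
    using assms by (auto simp: partition_on_def)
  have sub: "p \<subseteq> A" if "p \<in> P" for p using that assms(1) by (auto simp: partition_on_def)
  have sub': "p \<subseteq> B" if "p \<in> Q" for p using that assms(2) by (auto simp: partition_on_def)
  fix p q assume pq: "p \<in> P \<union> Q" "q \<in> P \<union> Q" "p \<noteq> q"
  then consider "p \<in> P" "q \<in> P" | "p \<in> Q" "q \<in> Q" | "p \<in> P" "q \<in> Q" | "p \<in> Q" "q \<in> P"
    by blast
  then show "disjnt p q"
  proof cases
    case 1
    then show ?thesis using partition_onD2[OF assms(1)] pq(3) by (simp add: disjnt_def disjointD)
  next
    case 2
    then show ?thesis using partition_onD2[OF assms(2)] pq(3) by (simp add: disjnt_def disjointD)
  next
    case 3
    then show ?thesis using sub[of p] sub'[of q] assms(3) by (auto simp: disjnt_def)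
  next
    case 4
    then show ?thesis using sub[of q] sub'[of p] assms(3) by (auto simp: disjnt_def)
  qed
qed

lemma partition_on_subsets:
  assumes "partition_on (A \<union> B) P" "A \<inter> B = {}" "\<And>V. V \<in> P \<Longrightarrow> V \<subseteq> A \<or> V \<subseteq> B"
  shows "partition_on A {V \<in> P. V \<subseteq> A}"
proof (rule partition_onI)
  have "x \<in> \<Union>{V \<in> P. V \<subseteq> A}" if "x \<in> A" for x
  proof -
    have "x \<in> \<Union>P" using that assms(1) by (simp add: partition_on_def)
    then obtain V where V: "V \<in> P" "x \<in> V" by (rule UnionE)
    then have "V \<subseteq> A" using assms(3)[OF V(1)] assms(2) that by auto
    then show ?thesis using V by auto
  qed
  then show "\<Union>{V \<in> P. V \<subseteq> A} = A" by blast
  show "\<And>p p'. p \<in> {V \<in> P. V \<subseteq> A} \<Longrightarrow> p' \<in> {V \<in> P. V \<subseteq> A} \<Longrightarrow> p \<noteq> p' \<Longrightarrow> disjnt p p'"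
    using assms(1) by (auto simp: partition_on_def disjoint_def disjnt_def)
  show "{} \<notin> {V \<in> P. V \<subseteq> A}"
    using assms(1) by (auto simp: partition_on_def)
qed

lemma noncrossingD:
  assumes "noncrossing P" "V \<in> P" "W \<in> P" "V \<noteq> W" "i \<in> V" "j \<in> W" "k \<in> V" "l \<in> W"
  shows "\<not> (i < j \<and> j < k \<and> k < l)"
  using assms unfolding noncrossing_def by metis

text \<open>A crossing i < j < k < l between a block in G and one in E places j or k in E between
  two points of G, which \<open>conv\<close> forbids.\<close>

lemma noncrossing_Un:
  assumes P: "noncrossing P" and Q: "noncrossing Q"
    and sub: "\<And>V. V \<in> P \<Longrightarrow> V \<subseteq> G" "\<And>V. V \<in> Q \<Longrightarrow> V \<subseteq> E"
    and conv: "\<And>g e g'. g \<in> G \<Longrightarrow> e \<in> E \<Longrightarrow> g' \<in> G \<Longrightarrow> \<not> (g < e \<and> e < g')"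
  shows "noncrossing (P \<union> Q)"
  unfolding noncrossing_def
proof (intro notI, elim bexE conjE)
  fix V W i j k l
  assume VW: "V \<in> P \<union> Q" "W \<in> P \<union> Q" "V \<noteq> W" "i \<in> V" "j \<in> W" "k \<in> V" "l \<in> W" "i < j" "j < k" "k < l"
  consider "V \<in> P" "W \<in> P" | "V \<in> Q" "W \<in> Q" | "V \<in> P" "W \<in> Q" | "V \<in> Q" "W \<in> P"
    using VW(1,2) by blast
  then show False
  proof cases
    case 1 then show False using noncrossingD[OF P _ _ VW(3-7)] VW(8-10) by simp
  next
    case 2 then show False using noncrossingD[OF Q _ _ VW(3-7)] VW(8-10) by simp
  next
    case 3 then show False using VW(4-9) sub(1)[of V] sub(2)[of W] conv[of i j k] by auto
  next
    case 4 then show False using VW(4-10) sub(1)[of W] sub(2)[of V] conv[of j k l] by auto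
  qed
qed

lemma noncrossing_subset: "noncrossing P \<Longrightarrow> Q \<subseteq> P \<Longrightarrow> noncrossing Q"
  unfolding noncrossing_def by blast

text \<open>Partitions that respect the cut into G and E correspond to pairs, since
  \<open>conv\<close> excludes crossings between the two sides, and the product factorises. The
  nonempty W can only lie in a block on the E side.\<close>

lemma nc_sum_gap:
  fixes G E :: "'i::linorder set"
  assumes fin: "finite G" "finite E" and disj: "G \<inter> E = {}"
    and conv: "\<And>g e g'. g \<in> G \<Longrightarrow> e \<in> E \<Longrightarrow> g' \<in> G \<Longrightarrow> \<not> (g < e \<and> e < g')"
    and W: "W \<noteq> {}" "W \<subseteq> E"
  shows "(\<Sum>\<pi> | \<pi> \<in> nc_partitions (G \<union> E) \<and> (\<forall>V\<in>\<pi>. V \<subseteq> G \<or> V \<subseteq> E) \<and> (\<exists>V\<in>\<pi>. W \<subseteq> V). \<Prod>V\<in>\<pi>. f V) =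
    nc_sum f {} G * nc_sum f W E" (is "sum ?p ?T = _")
proof -
  have dj: "V = {}" if "V \<subseteq> G" "V \<subseteq> E" for V
    using that disj by blast
  have "sum ?p ?T = (\<Sum>(\<sigma>, \<tau>)\<in>nc_partitions G \<times> {\<tau> \<in> nc_partitions E. \<exists>V\<in>\<tau>. W \<subseteq> V}. (\<Prod>V\<in>\<sigma>. f V) * (\<Prod>V\<in>\<tau>. f V))"
  proof (rule sum.reindex_bij_witness[where
        j = "\<lambda>\<pi>. ({V \<in> \<pi>. V \<subseteq> G}, {V \<in> \<pi>. V \<subseteq> E})" and i = "\<lambda>(\<sigma>, \<tau>). \<sigma> \<union> \<tau>"])
    fix \<pi> assume \<pi>: "\<pi> \<in> ?T"
    then have part: "partition_on (G \<union> E) \<pi>" and nc: "noncrossing \<pi>"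
      and sub: "\<And>V. V \<in> \<pi> \<Longrightarrow> V \<subseteq> G \<or> V \<subseteq> E" and ex: "\<exists>V\<in>\<pi>. W \<subseteq> V"
      by (auto simp: nc_partitions_def)
    have un: "{V \<in> \<pi>. V \<subseteq> G} \<union> {V \<in> \<pi>. V \<subseteq> E} = \<pi>" using sub by blast
    then show "(case ({V \<in> \<pi>. V \<subseteq> G}, {V \<in> \<pi>. V \<subseteq> E}) of (\<sigma>, \<tau>) \<Rightarrow> \<sigma> \<union> \<tau>) = \<pi>" by simp
    have "partition_on G {V \<in> \<pi>. V \<subseteq> G}"
      using part disj sub by (rule partition_on_subsets)
    moreover have "partition_on E {V \<in> \<pi>. V \<subseteq> E}"
      using part disj sub by (intro partition_on_subsets[of E G]) (auto simp: Un_commute)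
    moreover have "\<exists>V\<in>{V \<in> \<pi>. V \<subseteq> E}. W \<subseteq> V"
    proof -
      obtain V where V: "V \<in> \<pi>" "W \<subseteq> V" using ex by blast
      have "\<not> V \<subseteq> G" using dj[of W] W V(2) by auto
      then show ?thesis using V sub[OF V(1)] by auto
    qed
    ultimately show "({V \<in> \<pi>. V \<subseteq> G}, {V \<in> \<pi>. V \<subseteq> E}) \<in> nc_partitions G \<times> {\<tau> \<in> nc_partitions E. \<exists>V\<in>\<tau>. W \<subseteq> V}"
      using noncrossing_subset[OF nc, of "{V \<in> \<pi>. V \<subseteq> G}"] noncrossing_subset[OF nc, of "{V \<in> \<pi>. V \<subseteq> E}"]
      by (simp add: nc_partitions_def)
    have "{} \<notin> \<pi>" "finite \<pi>"
      using fin finite_elements[OF _ part] partition_onD3[OF part] by simp_all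
    then have "(\<Prod>V\<in>{V \<in> \<pi>. V \<subseteq> G} \<union> {V \<in> \<pi>. V \<subseteq> E}. f V) = (\<Prod>V | V \<in> \<pi> \<and> V \<subseteq> G. f V) * (\<Prod>V | V \<in> \<pi> \<and> V \<subseteq> E. f V)"
      using dj by (intro prod.union_disjoint) auto
    then show "(case ({V \<in> \<pi>. V \<subseteq> G}, {V \<in> \<pi>. V \<subseteq> E}) of (\<sigma>, \<tau>) \<Rightarrow> (\<Prod>V\<in>\<sigma>. f V) * (\<Prod>V\<in>\<tau>. f V)) = ?p \<pi>"
      by (simp add: un)
  next
    fix x assume "x \<in> nc_partitions G \<times> {\<tau> \<in> nc_partitions E. \<exists>V\<in>\<tau>. W \<subseteq> V}"
    then obtain \<sigma> \<tau> where x: "x = (\<sigma>, \<tau>)" and ex: "\<exists>V\<in>\<tau>. W \<subseteq> V"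
      and part: "partition_on G \<sigma>" "partition_on E \<tau>" and nc: "noncrossing \<sigma>" "noncrossing \<tau>"
      by (auto simp: nc_partitions_def)
    have sub: "\<And>V. V \<in> \<sigma> \<Longrightarrow> V \<subseteq> G" "\<And>V. V \<in> \<tau> \<Longrightarrow> V \<subseteq> E"
      using part by (auto simp: partition_on_def)
    have ne: "{} \<notin> \<sigma>" "{} \<notin> \<tau>" using part by (auto simp: partition_on_def)
    have "noncrossing (\<sigma> \<union> \<tau>)" using nc sub conv by (rule noncrossing_Un)
    then show "(case x of (\<sigma>, \<tau>) \<Rightarrow> \<sigma> \<union> \<tau>) \<in> ?T"
      using partition_on_Un[OF part disj] sub ex by (auto simp: x nc_partitions_def)
    have "\<not> V \<subseteq> E" if "V \<in> \<sigma>" for V using sub(1)[OF that] ne(1) that dj[of V] by auto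
    moreover have "\<not> V \<subseteq> G" if "V \<in> \<tau>" for V using sub(2)[OF that] ne(2) that dj[of V] by auto
    ultimately have "{V \<in> \<sigma> \<union> \<tau>. V \<subseteq> G} = \<sigma>" "{V \<in> \<sigma> \<union> \<tau>. V \<subseteq> E} = \<tau>"
      using sub by blast+
    then show "(\<lambda>\<pi>. ({V \<in> \<pi>. V \<subseteq> G}, {V \<in> \<pi>. V \<subseteq> E})) (case x of (\<sigma>, \<tau>) \<Rightarrow> \<sigma> \<union> \<tau>) = x"
      by (simp add: x)
  qed
  also have "\<dots> = nc_sum f {} G * nc_sum f W E"
    using W(1) by (simp add: nc_sum_def sum_product sum.cartesian_product)
  finally show ?thesis .
qed

section \<open>Splitting a sum along one block\<close>

lemma nc_partitions_block_all:
  assumes "U \<noteq> {}"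
  shows "{\<pi> \<in> nc_partitions U. \<exists>V\<in>\<pi>. U \<subseteq> V} = {{U}}"
proof -
  have "\<pi> = {U}" if \<pi>: "partition_on U \<pi>" and V: "V \<in> \<pi>" "U \<subseteq> V" for \<pi> V
  proof -
    have "V = U" using \<pi> V by (auto simp: partition_on_def)
    moreover have "V' = V" if "V' \<in> \<pi>" for V'
      using \<pi> V that unfolding partition_on_def disjoint_def by (metis Int_absorb2 Sup_upper subset_trans)
    ultimately show ?thesis using V by blast
  qed
  moreover have "{U} \<in> nc_partitions U"
    using assms by (auto simp: nc_partitions_def partition_on_space noncrossing_def)
  ultimately show ?thesis by (auto simp: nc_partitions_def)
qed

lemma nc_sum_block_all: "U \<noteq> {} \<Longrightarrow> nc_sum f U U = f U"
  by (simp add: nc_sum_def nc_partitions_block_all)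

text \<open>The sum is split by the element \<open>j\<close> that follows \<open>U\<close> in its block; the points strictly between
  \<open>U\<close> and \<open>j\<close> are partitioned among themselves.\<close>

lemma nc_sum_step:
  fixes U :: "nat set"
  assumes U: "U \<noteq> {}" "U \<subseteq> {..<p}"
  shows "nc_sum f U (U \<union> {p..<n}) = nc_sum f {} {p..<n} * f U +
    (\<Sum>j=p..<n. nc_sum f {} {p..<j} * nc_sum f (insert j U) (insert j U \<union> {Suc j..<n}))"
proof -
  let ?A = "U \<union> {p..<n}"
  have fU: "finite U" using U(2) finite_subset by blast
  \<comment> \<open>Partitions that treat the gap {p..<j} separately and keep W in one block: the
    form that \<open>nc_sum_gap\<close> evaluates.\<close>
  define T where "T j W = {\<pi> \<in> nc_partitions ?A. (\<forall>V\<in>\<pi>. V \<subseteq> {p..<j} \<or> V \<subseteq> U \<union> {j..<n}) \<and> (\<exists>V\<in>\<pi>. W \<subseteq> V)}" for j W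
  have fT: "finite (T j W)" for j W
    using finite_nc_partitions[of ?A] fU unfolding T_def by simp
  have T: "(\<Sum>\<pi>\<in>T j W. \<Prod>V\<in>\<pi>. f V) = nc_sum f {} {p..<j} * nc_sum f W (U \<union> {j..<n})"
    if "p \<le> j" "j \<le> n \<or> p = j" "W \<noteq> {}" "W \<subseteq> U \<union> {j..<n}" for j W
  proof -
    have "?A = {p..<j} \<union> (U \<union> {j..<n})" using that(1,2) by auto
    then show ?thesis unfolding T_def
      using nc_sum_gap[of "{p..<j}" "U \<union> {j..<n}" W f] fU U(2) that(3,4) by fastforce
  qed
  \<comment> \<open>\<open>T (max p n) U\<close> is the case where U is a complete block; the
    maximum keeps the cut at or above p when n < p.\<close>
  have eq: "{\<pi> \<in> nc_partitions ?A. \<exists>V\<in>\<pi>. U \<subseteq> V} = T (max p n) U \<union> (\<Union>j\<in>{p..<n}. T j (insert j U))"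
  proof (intro equalityI subsetI)
    fix \<pi> assume "\<pi> \<in> {\<pi> \<in> nc_partitions ?A. \<exists>V\<in>\<pi>. U \<subseteq> V}"
    then obtain V where \<pi>: "\<pi> \<in> nc_partitions ?A" and V: "V \<in> \<pi>" "U \<subseteq> V" by blast
    have sub: "V' \<subseteq> ?A" if "V' \<in> \<pi>" for V' using \<pi> that by (auto simp: nc_partitions_def partition_on_def)
    have dis: "V' \<inter> V = {}" if "V' \<in> \<pi>" "V' \<noteq> V" for V'
      using \<pi> that V by (auto simp: nc_partitions_def partition_on_def disjoint_def)
    show "\<pi> \<in> T (max p n) U \<union> (\<Union>j\<in>{p..<n}. T j (insert j U))"
    proof (cases "V = U")
      case True
      have "V' \<subseteq> {p..<max p n} \<or> V' \<subseteq> U \<union> {max p n..<n}" if "V' \<in> \<pi>" for V'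
        using sub[OF that] dis[OF that] True by (cases "V' = V") auto
      then show ?thesis using \<pi> V by (auto simp: T_def)
    next
      case False
      define j where "j = Min (V - U)"
      have fin: "finite (V - U)" using sub[OF V(1)] fU by (meson finite_Diff finite_UnI finite_atLeastLessThan finite_subset)
      moreover have "V - U \<noteq> {}" using False V by blast
      ultimately have jV: "j \<in> V - U" and jmin: "\<And>i. i \<in> V - U \<Longrightarrow> j \<le> i"
        using Min_in[of "V - U"] Min_le[of "V - U"] unfolding j_def by auto
      have j: "j \<in> {p..<n}" using jV sub[OF V(1)] by blast
      obtain u where u: "u \<in> U" using U by blast
      \<comment> \<open>Another block with points y < j < x would cross V through u < y < j <
        x.\<close>
      have "V' \<subseteq> {p..<j} \<or> V' \<subseteq> U \<union> {j..<n}" if V': "V' \<in> \<pi>" for V'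
      proof (cases "V' = V")
        case True
        then show ?thesis using jmin sub[OF V'] by fastforce
      next
        case False
        note d = dis[OF V' False]
        then have V'sub: "V' \<subseteq> {p..<n}" using sub[OF V'] V by blast
        show ?thesis
        proof (rule ccontr)
          assume "\<not> ?thesis"
          then obtain x y where "x \<in> V'" "\<not> x < j" "y \<in> V'" "y < j"
            using V'sub by (metis UnCI atLeastLessThan_iff subset_iff not_le)
          moreover have "x \<noteq> j" using d jV \<open>x \<in> V'\<close> by blast
          moreover have "u < y" using u U(2) V'sub \<open>y \<in> V'\<close> by fastforce
          ultimately have "u < y" "y < j" "j < x" by auto
          then show False
            using noncrossingD[of \<pi> V V' u y j x] \<pi> V V' False \<open>x \<in> V'\<close> \<open>y \<in> V'\<close> u jV
            by (auto simp: nc_partitions_def)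
        qed
      qed
      then have "\<pi> \<in> T j (insert j U)" using \<pi> V jV unfolding T_def by blast
      then show ?thesis using j by blast
    qed
  qed (auto simp: T_def)
  have d1: "T (max p n) U \<inter> T j (insert j U) = {}" if j: "j \<in> {p..<n}" for j
  proof -
    have False if \<pi>: "\<pi> \<in> T (max p n) U" "\<pi> \<in> T j (insert j U)" for \<pi>
    proof -
      obtain V where V: "V \<in> \<pi>" "insert j U \<subseteq> V" using \<pi>(2) by (auto simp: T_def)
      have "V \<subseteq> {p..<max p n} \<or> V \<subseteq> U \<union> {max p n..<n}"
        using \<pi>(1) V(1) by (simp add: T_def)
      then have "insert j U \<subseteq> {p..<max p n} \<or> insert j U \<subseteq> U \<union> {max p n..<n}"
        using V(2) by (meson subset_trans)
      then show False using U j by fastforce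
    qed
    then show ?thesis by blast
  qed
  \<comment> \<open>A block containing U and i < j would meet both sides of the cut made by
    \<open>T j\<close>, as U is nonempty and lies below p.\<close>
  have d2: "T i (insert i U) \<inter> T j (insert j U) = {}" if ij: "i \<in> {p..<n}" "j \<in> {p..<n}" "i < j" for i j
  proof -
    have False if \<pi>: "\<pi> \<in> T i (insert i U)" "\<pi> \<in> T j (insert j U)" for \<pi>
    proof -
      obtain V where V: "V \<in> \<pi>" "insert i U \<subseteq> V" using \<pi>(1) by (auto simp: T_def)
      have "V \<subseteq> {p..<j} \<or> V \<subseteq> U \<union> {j..<n}"
        using \<pi>(2) V(1) by (simp add: T_def)
      then have "insert i U \<subseteq> {p..<j} \<or> insert i U \<subseteq> U \<union> {j..<n}"
        using V(2) by (meson subset_trans)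
      then show False using U ij by fastforce
    qed
    then show ?thesis by blast
  qed
  have "nc_sum f U ?A = (\<Sum>\<pi>\<in>T (max p n) U. \<Prod>V\<in>\<pi>. f V) + (\<Sum>\<pi>\<in>(\<Union>j\<in>{p..<n}. T j (insert j U)). \<Prod>V\<in>\<pi>. f V)"
  proof -
    have "nc_sum f U ?A = (\<Sum>\<pi>\<in>T (max p n) U \<union> (\<Union>j\<in>{p..<n}. T j (insert j U)). \<Prod>V\<in>\<pi>. f V)"
      unfolding nc_sum_def eq[symmetric] using U(1) by simp
    also have "\<dots> = (\<Sum>\<pi>\<in>T (max p n) U. \<Prod>V\<in>\<pi>. f V) + (\<Sum>\<pi>\<in>(\<Union>j\<in>{p..<n}. T j (insert j U)). \<Prod>V\<in>\<pi>. f V)"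
    proof (rule sum.union_disjoint)
      show "T (max p n) U \<inter> (\<Union>j\<in>{p..<n}. T j (insert j U)) = {}" using d1 by blast
    qed (simp_all add: fT)
    finally show ?thesis .
  qed
  also have "(\<Sum>\<pi>\<in>(\<Union>j\<in>{p..<n}. T j (insert j U)). \<Prod>V\<in>\<pi>. f V) = (\<Sum>j=p..<n. \<Sum>\<pi>\<in>T j (insert j U). \<Prod>V\<in>\<pi>. f V)"
  proof (intro sum.UNION_disjoint ballI impI)
    fix i j assume "i \<in> {p..<n}" "j \<in> {p..<n}" "i \<noteq> j"
    then show "T i (insert i U) \<inter> T j (insert j U) = {}"
      using d2[of i j] d2[of j i] by (cases i j rule: linorder_cases) (auto simp: Int_commute)
  qed (simp_all add: fT)
  also have "\<dots> = (\<Sum>j=p..<n. nc_sum f {} {p..<j} * nc_sum f (insert j U) (insert j U \<union> {Suc j..<n}))"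
  proof (intro sum.cong refl)
    fix j assume j: "j \<in> {p..<n}"
    then have "U \<union> {j..<n} = insert j U \<union> {Suc j..<n}" by auto
    then show "(\<Sum>\<pi>\<in>T j (insert j U). \<Prod>V\<in>\<pi>. f V) = nc_sum f {} {p..<j} * nc_sum f (insert j U) (insert j U \<union> {Suc j..<n})"
      using T[of j "insert j U"] j by auto
  qed
  also have "(\<Sum>\<pi>\<in>T (max p n) U. \<Prod>V\<in>\<pi>. f V) = nc_sum f {} {p..<n} * f U"
    using T[of "max p n" U] U(1) nc_sum_block_all[OF U(1), of f] by (cases "p \<le> n") (auto simp: max_def)
  finally show ?thesis .
qed

section \<open>Congruence, relabelling and sublists\<close>

lemma nc_sum_cong: "(\<And>V. V \<subseteq> A \<Longrightarrow> V \<noteq> {} \<Longrightarrow> f V = g V) \<Longrightarrow> nc_sum f W A = nc_sum g W A"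
  unfolding nc_sum_def
  by (rule sum.cong[OF refl], rule prod.cong[OF refl]) (auto simp: nc_partitions_def partition_on_def)

lemma nc_sum_empty [simp]: "nc_sum f {} {} = 1"
proof -
  have "nc_partitions {} = {{} :: 'a set set}"
    by (auto simp: nc_partitions_def noncrossing_def partition_on_empty)
  then show ?thesis by (simp add: nc_sum_def)
qed

lemma noncrossing_image:
  assumes "strict_mono (e :: 'i::linorder \<Rightarrow> 'j::linorder)"
  shows "noncrossing ((`) e ` P) \<longleftrightarrow> noncrossing P"
  using strict_mono_less[OF assms] strict_mono_imp_inj_on[OF assms]
  unfolding noncrossing_def by (simp add: inj_image_eq_iff)

text \<open>Increasing maps preserve and reflect crossings. The use is to shift a gap {p..<j} to an
  initial segment, where \<open>moment_cumulant\<close> applies.\<close>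

lemma nc_sum_image:
  assumes e: "strict_mono (e :: 'i::linorder \<Rightarrow> 'j::linorder)"
  shows "nc_sum f {} (e ` A) = nc_sum (\<lambda>V. f (e ` V)) {} A"
proof -
  have inj: "inj e" by (rule strict_mono_imp_inj_on[OF e])
  have inj': "inj ((`) e)" using inj by (simp add: inj_image_eq_iff inj_def)
  have mem: "(`) e ` P \<in> nc_partitions (e ` A)" if "P \<in> nc_partitions A" for P
  proof -
    have "{} \<notin> (`) e ` P" using that by (auto simp: nc_partitions_def partition_on_def)
    then show ?thesis
      using that partition_on_inj_image[of A P e] inj_on_subset[OF inj] noncrossing_image[OF e, of P]
      by (simp add: nc_partitions_def)
  qed
  have surj: "Q \<in> (`) ((`) e) ` nc_partitions A" if Q: "Q \<in> nc_partitions (e ` A)" for Q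
  proof -
    define P where "P = (-`) e ` Q"
    have part: "partition_on (e ` A) Q" and nc: "noncrossing Q"
      using Q by (auto simp: nc_partitions_def)
    have inv: "e ` (e -` V) = V" if "V \<in> Q" for V
      using part that by (auto simp: partition_on_def image_vimage_eq)
    then have eq: "(`) e ` P = Q" by (simp add: P_def image_image)
    have "{} \<notin> P"
    proof
      assume "{} \<in> P"
      then obtain V where V: "V \<in> Q" "e -` V = {}" by (auto simp: P_def)
      have "V = {}" using inv[OF V(1)] unfolding V(2) by simp
      then show False using V(1) partition_onD3[OF part] by simp
    qed
    then have "partition_on A P"
      using partition_on_vimage[OF part, of e] inj by (simp add: P_def inj_vimage_image_eq)
    moreover have "noncrossing P"
      using nc noncrossing_image[OF e, of P] eq by simp
    ultimately have "P \<in> nc_partitions A" by (simp add: nc_partitions_def)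
    then show ?thesis unfolding eq[symmetric] by (rule imageI)
  qed
  have "nc_partitions (e ` A) = (`) ((`) e) ` nc_partitions A"
    by (rule equalityI; rule subsetI) (erule surj, erule imageE, simp add: mem)
  moreover have "inj_on ((`) ((`) e)) (nc_partitions A)"
    using inj' by (simp add: inj_image_eq_iff inj_on_def)
  ultimately show ?thesis
    by (simp add: nc_sum_def sum.reindex prod.reindex inj_on_subset[OF inj'])
qed

lemma nths_take: "V \<subseteq> {..<n} \<Longrightarrow> nths (take n xs) V = nths xs V"
proof -
  assume V: "V \<subseteq> {..<n}"
  show ?thesis
  proof (cases "n \<le> length xs")
    case True
    have "{i. i + n \<in> V} = {}" using V by auto
    then show ?thesis
      using nths_append[of "take n xs" "drop n xs" V] True by (simp add: min_def)
  qed simp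
qed

lemma nths_insert_greater:
  assumes U: "U \<subseteq> {..<j}" and j: "j < length xs"
  shows "nths xs (insert j U) = nths xs U @ [xs ! j]"
proof -
  have "insert j U \<subseteq> {..<Suc j}" using U by auto
  then have "nths xs (insert j U) = nths (take j xs @ [xs ! j]) (insert j U)"
    using j nths_take[of "insert j U" "Suc j" xs] by (simp add: take_Suc_conv_app_nth)
  also have "\<dots> = nths (take j xs) (insert j U) @ [xs ! j]"
    using j by (simp add: nths_append)
  also have "nths (take j xs) (insert j U) = nths (take j xs) U"
  proof -
    have "filter (\<lambda>p. snd p \<in> insert j U) (zip (take j xs) [0..<j]) =
        filter (\<lambda>p. snd p \<in> U) (zip (take j xs) [0..<j])"
      by (intro filter_cong refl) (auto dest: set_zip_rightD)
    then show ?thesis using j by (simp add: nths_def)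
  qed
  finally show ?thesis using U by (simp add: nths_take)
qed

section \<open>The moment series and the cumulant bound\<close>

text \<open>On the empty list \<open>free_cumulant\<close> takes the junk value \<open>\<phi> 1 - 1\<close>.\<close>

definition cumulant_series :: "('a::monoid_mult \<Rightarrow> complex) \<Rightarrow> 'a list \<Rightarrow> complex"
  where "cumulant_series \<phi> w = (if w = [] then 1 else free_cumulant \<phi> w)"

text \<open>The block of the first point is read letter by letter: \<open>nc_sum_step\<close> picks
  its next element, and every gap skipped contributes a moment. That is the recursion of
  \<open>comp_series\<close>.\<close>

theorem moment_series_fixpoint:
  fixes \<phi> :: "'a::monoid_mult \<Rightarrow> complex"
  assumes "\<phi> 1 = 1"
  defines "M \<equiv> \<lambda>w. \<phi> (prod_list w)"
  shows "M = comp_series (cumulant_series \<phi>) M"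
proof
  fix xs :: "'a list"
  let ?C = "cumulant_series \<phi>"
  define n where "n = length xs"
  define f where "f V = ?C (nths xs V)" for V
  \<comment> \<open>Each gap sums to the moment of its subword; the empty gap gives \<phi> 1 =
    1.\<close>
  have gap: "nc_sum f {} {p..<j} = M (take (j - p) (drop p xs))" if "p \<le> j" "j \<le> n" for p j
  proof (cases "p = j")
    case False
    define ys where "ys = take (j - p) (drop p xs)"
    have len: "length ys = j - p" using that by (simp add: ys_def n_def)
    have ys: "ys \<noteq> []" using len that False by auto
    have "nc_sum f {} {p..<j} = nc_sum f {} ((+) p ` {..<j - p})"
      using that by (simp add: lessThan_atLeast0)
    also have "\<dots> = nc_sum (\<lambda>V. f ((+) p ` V)) {} {..<j - p}"
      by (rule nc_sum_image) (simp add: strict_mono_def)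
    also have "\<dots> = nc_sum (\<lambda>V. free_cumulant \<phi> (nths ys V)) {} {..<j - p}"
    proof (rule nc_sum_cong)
      fix V assume V: "V \<subseteq> {..<j - p}" "V \<noteq> {}"
      then have "nths xs ((+) p ` V) = nths ys V"
        by (simp add: ys_def nths_take nths_drop)
      moreover have "nths ys V \<noteq> []"
        using V len by (auto simp: set_nths simp flip: set_empty)
      ultimately show "f ((+) p ` V) = free_cumulant \<phi> (nths ys V)"
        by (simp add: f_def cumulant_series_def)
    qed
    also have "\<dots> = M ys"
      using moment_cumulant[OF ys, of \<phi>] by (simp add: M_def len NC_eq_nc_partitions nc_sum_def)
    finally show ?thesis by (simp add: ys_def)
  qed (simp add: M_def assms)
  \<comment> \<open>\<open>U\<close> is the part of the block read so far and \<open>p\<close> the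
    next unread position. Prefixing \<open>nths xs U\<close> is the iterated left derivative of the
    cumulant series.\<close>
  have step: "nc_sum f U (U \<union> {p..<n}) = (M \<star> comp_series (\<lambda>v. ?C (nths xs U @ v)) M) (drop p xs)"
    if "U \<noteq> {}" "U \<subseteq> {..<p}" "p \<le> n" for U p
    using that
  proof (induction "n - p" arbitrary: U p rule: less_induct)
    case less
    let ?c = "comp_series (\<lambda>v. ?C (nths xs U @ v)) M"
    have "nc_sum f {} {p..<j} * nc_sum f (insert j U) (insert j U \<union> {Suc j..<n}) =
        M (take (j - p) (drop p xs)) * ?c (drop j xs)" if j: "j \<in> {p..<n}" for j
    proof -
      have "U \<subseteq> {..<j}" using less.prems j by auto
      then have "nths xs (insert j U) = nths xs U @ [xs ! j]"
        using j by (intro nths_insert_greater) (auto simp: n_def)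
      moreover have "nc_sum f (insert j U) (insert j U \<union> {Suc j..<n}) =
          (M \<star> comp_series (\<lambda>v. ?C (nths xs (insert j U) @ v)) M) (drop (Suc j) xs)"
        using less.prems j \<open>U \<subseteq> {..<j}\<close> by (intro less.hyps) auto
      moreover have "drop j xs = xs ! j # drop (Suc j) xs"
        using j by (simp add: n_def Cons_nth_drop_Suc)
      ultimately show ?thesis
        using j gap[of p j] by (simp add: comp_series_Cons del: comp_series.simps(2))
    qed
    then have "nc_sum f U (U \<union> {p..<n}) = M (drop p xs) * f U +
        (\<Sum>j=p..<n. M (take (j - p) (drop p xs)) * ?c (drop j xs))"
      using gap[of p n] less.prems unfolding nc_sum_step[OF less.prems(1,2)] by (simp add: n_def)
    \<comment> \<open>The completed block is the missing summand j = n of the convolution, with the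
      empty word left over.\<close>
    also have "f U = ?c (drop n xs)"
      by (simp add: f_def n_def)
    also have "M (drop p xs) * ?c (drop n xs) + (\<Sum>j=p..<n. M (take (j - p) (drop p xs)) * ?c (drop j xs)) =
        (\<Sum>j=p..n. M (take (j - p) (drop p xs)) * ?c (drop j xs))"
      using less.prems by (simp add: n_def sum.last_plus)
    also have "\<dots> = (M \<star> ?c) (drop p xs)"
      unfolding conv_def using less.prems
      by (intro sum.reindex_bij_witness[where i = "\<lambda>i. i + p" and j = "\<lambda>j. j - p"]) (auto simp: n_def)
    finally show ?case .
  qed
  show "M xs = comp_series ?C M xs"
  proof (cases xs)
    case Nil
    then show ?thesis by (simp add: M_def assms cumulant_series_def)
  next
    case (Cons x w)
    have "M xs = nc_sum f {} {0..<n}"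
      using gap[of 0 n] by (simp add: n_def)
    \<comment> \<open>Some block contains 0, so marking {0} keeps every partition.\<close>
    also have "\<dots> = nc_sum f {0} ({0} \<union> {1..<n})"
    proof -
      have "n > 0" by (simp add: n_def Cons)
      then have A: "{0} \<union> {1..<n} = {0..<n}" by auto
      have "\<exists>V\<in>\<pi>. {0} \<subseteq> V" if "\<pi> \<in> nc_partitions {0..<n}" for \<pi>
      proof -
        have "0 \<in> \<Union>\<pi>" using that \<open>n > 0\<close> by (simp add: nc_partitions_def partition_on_def)
        then show ?thesis by blast
      qed
      then show ?thesis unfolding nc_sum_def A by (intro sum.cong) auto
    qed
    also have "\<dots> = (M \<star> comp_series (\<lambda>v. ?C (nths xs {0} @ v)) M) (drop 1 xs)"
      by (rule step) (auto simp: n_def Cons)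
    finally show ?thesis
      by (simp add: Cons comp_series_Cons nths_Cons del: comp_series.simps(2))
  qed
qed

section \<open>Norm estimates for cumulants\<close>

lemma norm_prod_list_le:
  fixes xs :: "'a::real_normed_algebra_1 list"
  shows "norm (prod_list xs) \<le> prod_list (map norm xs)"
proof (induction xs)
  case (Cons x xs)
  have "norm (x * prod_list xs) \<le> norm x * norm (prod_list xs)"
    by (rule norm_mult_ineq)
  also have "\<dots> \<le> norm x * prod_list (map norm xs)"
    using Cons by (intro mult_left_mono) auto
  finally show ?case by simp
qed simp

text \<open>The norms are the weights in \<open>inversion_bound\<close>, because contractivity
  bounds the moment of a word by the product of its norms.\<close>

theorem free_cumulant_bound:
  fixes \<phi> :: "'a::cstar_algebra \<Rightarrow> complex"
  assumes \<phi>: "state \<phi>" and "xs \<noteq> []"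
  shows "cmod (free_cumulant \<phi> xs) \<le> 1 / 2 * 16 ^ length xs * prod_list (map norm xs)"
proof -
  let ?C = "cumulant_series \<phi>" and ?M = "\<lambda>w. \<phi> (prod_list w)"
  have "?M = comp_series ?C ?M"
    using \<phi> by (intro moment_series_fixpoint) (simp add: state_def)
  then have C: "?C = comp_series ?M (left_inverse ?C)"
    by (rule comp_series_inversion) (simp add: left_inverse_conv cumulant_series_def)
  have "cmod (?C xs) \<le> majorant (length xs) * prod_list (map norm xs)"
  proof (rule inversion_bound[OF _ _ C])
    show "cmod (?M v) \<le> prod_list (map norm v)" for v
      using state_norm_le[OF \<phi>, of "prod_list v"] norm_prod_list_le[of v] by linarith
  qed simp
  also have "\<dots> \<le> 1 / 2 * 16 ^ length xs * prod_list (map norm xs)"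
    using assms(2) order_trans[OF norm_ge_zero norm_prod_list_le[of xs]]
    by (intro mult_right_mono majorant_le) (auto simp: Suc_le_eq)
  finally show ?thesis using assms(2) by (simp add: cumulant_series_def)
qed

lemma length_alternating: "length (alternating n x y) = 2 * n"
  by (induction n) (simp_all add: alternating_def)

lemma prod_norm_alternating:
  fixes x y :: "'a::real_normed_vector"
  shows "prod_list (map norm (alternating n x y)) = (norm x * norm y) ^ n"
  by (induction n) (simp_all add: alternating_def)

theorem lemma4p3:
  fixes \<phi> :: "'a::cstar_algebra \<Rightarrow> complex" and a :: 'a
  assumes "faithful_state \<phi>"
    and "R_diagonal \<phi> a"
  shows "\<forall>n\<ge>1. cmod (det_alpha \<phi> a n) \<le> 1 / 2 * (2 ^ 4 * norm a) ^ (2 * n) \<and>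
               cmod (det_beta \<phi> a n) \<le> 1 / 2 * (2 ^ 4 * norm a) ^ (2 * n)"
proof (intro allI impI)
  fix n :: nat assume n: "n \<ge> 1"
  have \<phi>: "state \<phi>" using assms(1) by (simp add: faithful_state_def)
  have ne: "alternating n x y \<noteq> []" for x y :: 'a
    using n length_alternating[of n x y] by auto
  show "cmod (det_alpha \<phi> a n) \<le> 1 / 2 * (2 ^ 4 * norm a) ^ (2 * n) \<and>
      cmod (det_beta \<phi> a n) \<le> 1 / 2 * (2 ^ 4 * norm a) ^ (2 * n)"
    \<comment> \<open>Length 2 n produces the factor 16 ^ (2 n), and \<open>norm_star\<close> makes
      the product of the norms \<open>norm a ^ (2 * n)\<close>.\<close>
    using free_cumulant_bound[OF \<phi> ne, of a "star a"] free_cumulant_bound[OF \<phi> ne, of "star a" a]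
    by (simp add: det_alpha_def det_beta_def length_alternating prod_norm_alternating
        power_mult_distrib power_mult power2_eq_square)
qed

end
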